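(* Let $A_i\in\mathbb{R}^{m_i\times n}$, $b_i\in\mathbb{R}^{m_i}$ and $l_i:\mathbb{R}^{m_i}\to\mathbb{R}$ for $i=1,\dots,p$, and let $r:\mathbb{R}^n\to\mathbb{R}$ be one of the following: $r(x)=\|x\|_q^q=\sum_j|x_j|^q$ with $0<q\le1$; the SCAD penalty; the MCP penalty; or any piecewise linear function. If (i) (Coercivity) $r(x)+\sum_{i=1}^pl_i(A_ix-b_i)$ is coercive; (ii) (Smoothness) for each $i=1,\dots,p$, $l_i$ is Lipschitz differentiable; then for sufficiently large $\beta$, the sequence $(x^k,\mathbf{z}^k,\mathbf{w}^k)$ generated by the ADMM algorithm given in the context has limit points, and all of its limit points are stationary points of the augmented Lagrangian $\mathcal{L}_\beta$.
   Context: The problem is $\min_{x\in\mathbb{R}^n}\ r(x)+\sum_{i=1}^pl_i(A_ix-b_i)$, reformulated as minimizing $r(x)+\sum_{i=1}^pl_i(A_iz_i-b_i)$ over $x,z_1,\dots,z_p\in\mathbb{R}^n$ subject to $x=z_i$ for all $i$. Write $\mathbf{z}=(z_1,\dots,z_p)$, $\mathbf{w}=(w_1,\dots,w_p)$, $w_i\in\mathbb{R}^n$. Augmented Lagrangian: $\mathcal{L}_\beta(x,\mathbf{z},\mathbf{w})=r(x)+\sum_{i=1}^p\big(l_i(A_iz_i-b_i)+\langle w_i,z_i-x\rangle+\frac{\beta}{2}\|z_i-x\|^2\big)$. A stationary point is a point where $0\in\partial\mathcal{L}_\beta$, with $\partial$ the general (limiting) subdifferential (Rockafellar–Wets, Def.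 8.3). ADMM: from arbitrary $x^0,\mathbf{z}^0,\mathbf{w}^0$, for $k=0,1,\dots$: $x^{k+1}\in\operatorname{argmin}_xr(x)+\frac{\beta}{2}\sum_{i=1}^p\|z_i^k+\frac{w_i^k}{\beta}-x\|^2$; then for $s=1,\dots,p$: $z_s^{k+1}\in\operatorname{argmin}_{z_s}l_s(A_sz_s-b_s)+\frac{\beta}{2}\|z_s+\frac{w_s^k}{\beta}-x^{k+1}\|^2$ and $w_s^{k+1}=w_s^k+\beta(z_s^{k+1}-x^{k+1})$. MCP: $r(x)=\sum_jP_{\gamma,\lambda}(x_j)$ with $\lambda,\gamma>0$, $P_{\gamma,\lambda}(t)=\lambda|t|-\frac{t^2}{2\gamma}$ if $|t|\le\gamma\lambda$ and $\frac12\gamma\lambda^2$ if $|t|\ge\gamma\lambda$. SCAD: $r(x)=\sum_jQ_{\gamma,\lambda}(x_j)$ with $\lambda>0$, $\gamma>1$, $Q_{\gamma,\lambda}(t)=\lambda|t|$ if $|t|\le\lambda$, $\frac{2\gamma\lambda|t|-t^2-\lambda^2}{2\gamma-2}$ if $\lambda<|t|\le\gamma\lambda$, and $\frac12(\gamma+1)\lambda^2$ if $|t|\ge\gamma\lambda$. Piecewise linear: there exist polyhedra $U_1,\dots,U_K\subset\mathbb{R}^n$, $a_i\in\mathbb{R}^n$, $c_i\in\mathbb{R}$ with $\bigcup_i\overline{U_i}=\mathbb{R}^n$, $U_i\cap U_j=\emptyset$ for $i\neq j$, and $r(x)=a_i^Tx+c_i$ when $x\in U_i$. Lipschitz differentiable: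 differentiable with Lipschitz continuous gradient. Coercive: tends to $\infty$ as $\|x\|\to\infty$.
   Formalization: In the piecewise linear case, r is additionally assumed lower semicontinuous; without this the claim fails, e.g. n=p=1, l(y)=y²/2, A=1, b=0, r=0 for x<0, r=1+x for x≥0, where ADMM from z⁰=-1, w⁰=0 converges to the nonstationary point (0,0,0). *)

theory Defs
  imports "HOL-Analysis.Analysis"
begin

section \<open>Limiting subdifferential\<close>

(* Rockafellar--Wets, Def. 8.3, for functions with finite values.  The o(|x - x0|) error term
   is spelled out as an arbitrarily small multiple of |x - x0|. *)
definition regular_subdifferential :: "('a::euclidean_space \<Rightarrow> real) \<Rightarrow> 'a \<Rightarrow> 'a set" where
  "regular_subdifferential f x0 =
     {v. \<forall>e>0. \<forall>\<^sub>F x in nhds x0. f x \<ge> f x0 + v \<bullet> (x - x0) - e * norm (x - x0)}"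

definition limiting_subdifferential :: "('a::euclidean_space \<Rightarrow> real) \<Rightarrow> 'a \<Rightarrow> 'a set" where
  "limiting_subdifferential f x0 =
     {v. \<exists>X V. X \<longlonglongrightarrow> x0 \<and> (\<lambda>k. f (X k)) \<longlonglongrightarrow> f x0 \<and>
               (\<forall>k. V k \<in> regular_subdifferential f (X k)) \<and> V \<longlonglongrightarrow> v}"

definition stationary_point :: "('a::euclidean_space \<Rightarrow> real) \<Rightarrow> 'a \<Rightarrow> bool" where
  "stationary_point f u \<longleftrightarrow> 0 \<in> limiting_subdifferential f u"

definition seq_limit_point :: "(nat \<Rightarrow> 'a::topological_space) \<Rightarrow> 'a \<Rightarrow> bool" where
  "seq_limit_point X u \<longleftrightarrow> (\<exists>s. strict_mono s \<and> (X \<circ> s) \<longlonglongrightarrow> u)"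


section \<open>Regularity of the data\<close>

definition coercive :: "('a::real_normed_vector \<Rightarrow> real) \<Rightarrow> bool" where
  "coercive f \<longleftrightarrow> filterlim f at_top at_infinity"

definition lower_semicontinuous :: "('a::topological_space \<Rightarrow> real) \<Rightarrow> bool" where
  "lower_semicontinuous f \<longleftrightarrow> (\<forall>x c. c < f x \<longrightarrow> (\<forall>\<^sub>F y in nhds x. c < f y))"

(* The dimensions m_i of the spaces R^(m_i) may differ.  R^(m_i) is modelled as the subspace of
   real^'m of all vectors supported on an index set M with card M = m_i; the type 'm is arbitrary,
   hence large enough to accommodate any finite family of dimensions. *)
definition coord_space :: "'m set \<Rightarrow> (real^'m::finite) set" where
  "coord_space M = {y. \<forall>j. j \<notin> M \<longrightarrow> y $ j = 0}"

(* For a linear subspace S regarded as a Euclidean space of its own: values of f outside S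
   are irrelevant, and the gradient G y, being required to lie in S, is uniquely determined. *)
definition lipschitz_differentiable_on :: "'a::euclidean_space set \<Rightarrow> ('a \<Rightarrow> real) \<Rightarrow> bool" where
  "lipschitz_differentiable_on S f \<longleftrightarrow>
     (\<exists>G L. (\<forall>y\<in>S. G y \<in> S \<and> (f has_derivative (\<lambda>h. h \<bullet> G y)) (at y within S)) \<and>
            L-lipschitz_on S G)"


section \<open>Penalties\<close>

definition lq_penalty :: "real \<Rightarrow> real^'n::finite \<Rightarrow> real" where
  "lq_penalty q x = (\<Sum>j\<in>UNIV. \<bar>x $ j\<bar> powr q)"

definition mcp :: "real \<Rightarrow> real \<Rightarrow> real \<Rightarrow> real" where
  "mcp \<gamma> lam t =
     (if \<bar>t\<bar> \<le> \<gamma> * lam then lam * \<bar>t\<bar> - t\<^sup>2 / (2 * \<gamma>) else \<gamma> * lam\<^sup>2 / 2)"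

definition scad :: "real \<Rightarrow> real \<Rightarrow> real \<Rightarrow> real" where
  "scad \<gamma> lam t =
     (if \<bar>t\<bar> \<le> lam then lam * \<bar>t\<bar>
      else if \<bar>t\<bar> \<le> \<gamma> * lam then (2 * \<gamma> * lam * \<bar>t\<bar> - t\<^sup>2 - lam\<^sup>2) / (2 * \<gamma> - 2)
      else (\<gamma> + 1) * lam\<^sup>2 / 2)"

(* Finite intersections of closed and/or open half-spaces.  The library's polyhedra are closed,
   and pairwise disjoint closed sets could cover the space only trivially. *)
definition gen_polyhedron :: "'a::euclidean_space set \<Rightarrow> bool" where
  "gen_polyhedron U \<longleftrightarrow>
     (\<exists>F. finite F \<and> U = \<Inter>F \<and>
          (\<forall>h\<in>F. \<exists>a b. a \<noteq> 0 \<and> (h = {x. a \<bullet> x \<le> b} \<or> h = {x. a \<bullet> x < b})))"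

definition piecewise_linear :: "('a::euclidean_space \<Rightarrow> real) \<Rightarrow> bool" where
  "piecewise_linear r \<longleftrightarrow>
     (\<exists>(K::nat) U a c.
        (\<forall>i<K. gen_polyhedron (U i)) \<and>
        (\<Union>i<K. closure (U i)) = UNIV \<and>
        (\<forall>i<K. \<forall>j<K. i \<noteq> j \<longrightarrow> U i \<inter> U j = {}) \<and>
        (\<forall>i<K. \<forall>x\<in>U i. r x = a i \<bullet> x + c i))"


section \<open>Augmented Lagrangian and ADMM\<close>

(* The finite type 'p is the index set {1..p}. *)
definition aug_lagrangian ::
  "(real^'n::finite \<Rightarrow> real) \<Rightarrow> ('p::finite \<Rightarrow> real^'m::finite \<Rightarrow> real) \<Rightarrow>
   ('p \<Rightarrow> real^'n^'m) \<Rightarrow> ('p \<Rightarrow> real^'m) \<Rightarrow> real \<Rightarrow>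
   (real^'n) \<times> (real^'n^'p) \<times> (real^'n^'p) \<Rightarrow> real" where
  "aug_lagrangian r l A b \<beta> = (\<lambda>(x, z, w).
     r x + (\<Sum>i\<in>UNIV. l i (A i *v (z $ i) - b i) + (w $ i) \<bullet> (z $ i - x)
                       + \<beta> / 2 * (norm (z $ i - x))\<^sup>2))"

(* The updates for the indices s involve no other index s', so the order in which the
   blocks are processed within one iteration plays no role. *)
definition admm_sequence ::
  "(real^'n::finite \<Rightarrow> real) \<Rightarrow> ('p::finite \<Rightarrow> real^'m::finite \<Rightarrow> real) \<Rightarrow>
   ('p \<Rightarrow> real^'n^'m) \<Rightarrow> ('p \<Rightarrow> real^'m) \<Rightarrow> real \<Rightarrow>
   (nat \<Rightarrow> real^'n) \<Rightarrow> (nat \<Rightarrow> real^'n^'p) \<Rightarrow> (nat \<Rightarrow> real^'n^'p) \<Rightarrow> bool" where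
  "admm_sequence r l A b \<beta> x z w \<longleftrightarrow>
     (\<forall>k.
        is_arg_min
          (\<lambda>u. r u + \<beta> / 2 * (\<Sum>i\<in>UNIV. (norm (z k $ i + (w k $ i) /\<^sub>R \<beta> - u))\<^sup>2))
          (\<lambda>_. True) (x (Suc k)) \<and>
        (\<forall>s.
           is_arg_min
             (\<lambda>v. l s (A s *v v - b s) + \<beta> / 2 * (norm (v + (w k $ s) /\<^sub>R \<beta> - x (Suc k)))\<^sup>2)
             (\<lambda>_. True) (z (Suc k) $ s) \<and>
           w (Suc k) $ s = w k $ s + \<beta> *\<^sub>R (z (Suc k) $ s - x (Suc k))))"

end

theory Submission
  imports Defs
begin

text \<open>
  Write \<open>g i v = l i (A i *v v - b i)\<close>.  Each \<open>g i\<close> is differentiable with a Lipschitz gradient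
  \<open>G i\<close>, and each of the four penalties is lower semicontinuous.  The locale \<open>admm_run\<close> carries
  out the convergence argument for a lower semicontinuous \<open>r\<close> and smooth \<open>g i\<close> such that
  \<open>r + (\<Sum>i. g i)\<close> is coercive.  Let \<open>L\<close> be a common Lipschitz constant and
  let \<open>\<beta> > 4 * L\<close>.

  The optimality condition of the \<open>z\<close>-step together with the multiplier update says
  \<open>w = - G i z\<close> after every iteration (\<open>dual_eq_gradient\<close>), so that the dual increments are
  controlled by the increments of \<open>z\<close>.  Hence, from the second iteration on, the increase of the augmented Lagrangian in the
  multiplier update is at most \<open>L\<^sup>2 / \<beta>\<close> times the squared increment of \<open>z\<close>, while the
  \<open>z\<close>-step decreases it by at least \<open>\<beta> / 2 - L\<close> times the same quantity, and the \<open>x\<close>-step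
  never increases it.  The Lagrangian thus decreases by a positive multiple of the squared
  increment of \<open>z\<close> (\<open>lagrangian_descent\<close>).  The same formula for \<open>w\<close> shows that the Lagrangian
  dominates the objective at \<open>x\<close> plus a multiple of the squared residual
  (\<open>lagrangian_lower_bound\<close>).  Coercivity then bounds the iterates, which gives limit points.  As a
  coercive lower semicontinuous function, the objective is bounded below; hence so are the values
  of the Lagrangian, and the increments of \<open>z\<close> and \<open>w\<close> and the
  residuals \<open>z - x\<close> tend to zero.

  For stationarity, minimality of \<open>x (Suc k)\<close> yields a regular subgradient of \<open>r\<close> there.
  Adding the gradient of the smooth part of the Lagrangian gives a regular subgradient of the
  Lagrangian at the iterate whose entries are combinations of increments and residuals
  (\<open>lagrangian_regular_subgradient\<close>), hence tends to zero.  The values also converge along a convergent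
  subsequence: lower semicontinuity bounds \<open>r\<close> from below in the limit, and comparing
  \<open>x (Suc k)\<close> with the limit point in the \<open>x\<close>-step bounds it from above
  (\<open>limit_point_stationary\<close>).
\<close>

section \<open>Regular subgradients\<close>

lemma regular_subdifferential_minimizer:
  assumes "\<And>u. f x0 \<le> f u"
  shows "0 \<in> regular_subdifferential f x0"
  unfolding regular_subdifferential_def
proof (safe intro!: always_eventually)
  fix e :: real and x assume "e > 0"
  then show "f x0 + 0 \<bullet> (x - x0) - e * norm (x - x0) \<le> f x"
    using assms[of x] by (simp add: add_increasing2 diff_le_eq)
qed

text \<open>
  A differentiable summand contributes its gradient, because its linearization error can be
  absorbed in half of the permitted error.  Applied with the negative of a smooth function, this
  also turns a minimizer of a sum into a regular subgradient of the nonsmooth summand.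
\<close>

lemma regular_subdifferential_add_differentiable:
  fixes f h :: "'a::euclidean_space \<Rightarrow> real"
  assumes v: "v \<in> regular_subdifferential f x0"
    and h: "(h has_derivative (\<lambda>d. d \<bullet> y)) (at x0)"
  shows "v + y \<in> regular_subdifferential (\<lambda>x. f x + h x) x0"
  unfolding regular_subdifferential_def
proof safe
  fix e :: real assume e: "e > 0"
  have 1: "\<forall>\<^sub>F x in nhds x0. f x \<ge> f x0 + v \<bullet> (x - x0) - e/2 * norm (x - x0)"
    using v half_gt_zero[OF e] unfolding regular_subdifferential_def by blast
  obtain d where d: "d > 0" "\<And>x. norm (x - x0) < d \<Longrightarrow>
      norm (h x - h x0 - (x - x0) \<bullet> y) \<le> e/2 * norm (x - x0)"
    using h e unfolding has_derivative_at_alt by (metis half_gt_zero)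
  have 2: "\<forall>\<^sub>F x in nhds x0. h x \<ge> h x0 + y \<bullet> (x - x0) - e/2 * norm (x - x0)"
    unfolding eventually_nhds_metric
  proof (intro exI[of _ d] conjI allI impI)
    fix x assume "dist x x0 < d"
    then have "\<bar>h x - h x0 - (x - x0) \<bullet> y\<bar> \<le> e/2 * norm (x - x0)"
      using d(2)[of x] by (simp add: dist_norm)
    then show "h x0 + y \<bullet> (x - x0) - e/2 * norm (x - x0) \<le> h x"
      unfolding inner_commute[of y] by linarith
  qed (use d in auto)
  show "\<forall>\<^sub>F x in nhds x0. f x0 + h x0 + (v + y) \<bullet> (x - x0) - e * norm (x - x0) \<le> f x + h x"
    using 1 2 by eventually_elim (simp add: inner_add_left)
qed

text \<open>
  Treats a function of the first block as a function on the product, as is required for the penalty inside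
  the augmented Lagrangian; the error term only grows when the second block varies as well.
\<close>

lemma regular_subdifferential_fst:
  fixes f :: "'a::euclidean_space \<Rightarrow> real" and y0 :: "'b::euclidean_space"
  assumes "v \<in> regular_subdifferential f x0"
  shows "(v, 0) \<in> regular_subdifferential (\<lambda>u. f (fst u)) (x0, y0)"
  unfolding regular_subdifferential_def
proof safe
  fix e :: real assume e: "e > 0"
  have "\<forall>\<^sub>F x in nhds x0. f x \<ge> f x0 + v \<bullet> (x - x0) - e * norm (x - x0)"
    using assms e unfolding regular_subdifferential_def by blast
  moreover have "filterlim fst (nhds x0) (nhds (x0, y0))"
    using tendsto_fst[OF filterlim_ident[of "nhds (x0, y0)"]] by simp
  ultimately have "\<forall>\<^sub>F u in nhds (x0, y0). f (fst u) \<ge> f x0 + v \<bullet> (fst u - x0) - e * norm (fst u - x0)"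
    by (rule eventually_compose_filterlim)
  then show "\<forall>\<^sub>F u in nhds (x0, y0). f (fst (x0, y0)) + (v, 0) \<bullet> (u - (x0, y0))
      - e * norm (u - (x0, y0)) \<le> f (fst u)"
  proof eventually_elim
    case (elim u)
    have "norm (fst u - x0) \<le> norm (u - (x0, y0))"
      by (metis fst_conv fst_diff norm_fst_le prod.collapse)
    then have "e * norm (fst u - x0) \<le> e * norm (u - (x0, y0))"
      using e by simp
    with elim show ?case by (simp add: inner_prod_def)
  qed
qed

section \<open>Lower semicontinuity\<close>

lemma continuous_imp_lower_semicontinuous:
  assumes "continuous_on UNIV f"
  shows "lower_semicontinuous f"
  unfolding lower_semicontinuous_def
proof (intro allI impI)
  fix x c assume "c < f x"
  moreover have "(f \<longlongrightarrow> f x) (nhds x)"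
    using assms by (auto simp: continuous_on_def tendsto_at_iff_tendsto_nhds)
  ultimately show "\<forall>\<^sub>F y in nhds x. c < f y" by (simp add: order_tendstoD(1))
qed

lemma lower_semicontinuous_sequentially:
  assumes "lower_semicontinuous f" and "X \<longlonglongrightarrow> x" and "c < f x"
  shows "\<forall>\<^sub>F k in sequentially. c < f (X k)"
  using assms(1,3) unfolding lower_semicontinuous_def
  by (intro eventually_compose_filterlim[OF _ assms(2)]) blast

lemma lower_semicontinuous_add_continuous:
  assumes f: "lower_semicontinuous f" and h: "continuous_on UNIV h"
  shows "lower_semicontinuous (\<lambda>x. f x + h x)"
  unfolding lower_semicontinuous_def
proof (intro allI impI)
  fix x c assume c: "c < f x + h x"
  define e where "e = (f x + h x - c) / 2"
  have e: "e > 0" using c by (simp add: e_def)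
  have "\<forall>\<^sub>F y in nhds x. f x - e < f y"
    using f e unfolding lower_semicontinuous_def by simp
  moreover have "\<forall>\<^sub>F y in nhds x. h x - e < h y"
    using continuous_imp_lower_semicontinuous[OF h] e unfolding lower_semicontinuous_def by simp
  ultimately show "\<forall>\<^sub>F y in nhds x. c < f y + h y"
    by eventually_elim (simp add: e_def field_simps)
qed

text \<open>
  Otherwise points with values below every \<open>- n\<close> would accumulate somewhere in the compact set,
  against lower semicontinuity at the accumulation point.
\<close>

lemma lower_semicontinuous_bounded_below_on_compact:
  fixes f :: "'a::euclidean_space \<Rightarrow> real"
  assumes f: "lower_semicontinuous f" and S: "compact S"
  shows "\<exists>m. \<forall>x\<in>S. m \<le> f x"
proof (rule ccontr)
  assume "\<not> ?thesis"
  then have "\<forall>n::nat. \<exists>x\<in>S. f x < - real n" by (meson not_le)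
  then obtain X where X: "\<And>n. X n \<in> S" "\<And>n. f (X n) < - real n" by metis
  obtain x s where x: "strict_mono s" "(X \<circ> s) \<longlonglongrightarrow> x"
    using S X(1) by (metis compact_imp_seq_compact seq_compactE)
  have "\<forall>\<^sub>F k in sequentially. f x - 1 < f ((X \<circ> s) k)"
    by (rule lower_semicontinuous_sequentially[OF f x(2)]) simp
  moreover have "\<forall>\<^sub>F k in sequentially. 1 - f x \<le> real k"
    using filterlim_real_sequentially unfolding filterlim_at_top by blast
  ultimately have "\<forall>\<^sub>F k in sequentially. False"
  proof eventually_elim
    case (elim k)
    have "real k \<le> real (s k)" using seq_suble[OF x(1)] by simp
    with elim X(2)[of "s k"] show False by simp
  qed
  then show False by simp
qed

lemma coercive_sublevel_bounded:
  assumes "coercive f"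
  shows "\<exists>R. \<forall>x. f x \<le> c \<longrightarrow> norm x \<le> R"
proof -
  have "\<forall>\<^sub>F x in at_infinity. c + 1 \<le> f x"
    using assms unfolding coercive_def filterlim_at_top by blast
  then obtain B where "\<And>x. B \<le> norm x \<Longrightarrow> c + 1 \<le> f x"
    unfolding eventually_at_infinity by blast
  then have "norm x \<le> max 1 B" if "f x \<le> c" for x
    using that by (metis add_le_same_cancel1 le_max_iff_disj linorder_linear not_one_le_zero order_trans)
  then show ?thesis by blast
qed

lemma coercive_lower_semicontinuous_bounded_below:
  fixes f :: "'a::euclidean_space \<Rightarrow> real"
  assumes "coercive f" and "lower_semicontinuous f"
  shows "\<exists>m. \<forall>x. m \<le> f x"
proof -
  obtain R where R: "\<And>x. f x \<le> 0 \<Longrightarrow> norm x \<le> R"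
    using coercive_sublevel_bounded[OF assms(1)] by metis
  obtain m where m: "\<And>x. x \<in> cball 0 R \<Longrightarrow> m \<le> f x"
    using lower_semicontinuous_bounded_below_on_compact[OF assms(2) compact_cball] by blast
  have "min m 0 \<le> f x" for x
    using R[of x] m[of x] by (cases "f x \<le> 0") auto
  then show ?thesis by blast
qed

lemma lq_penalty_continuous:
  assumes "q > 0"
  shows "continuous_on UNIV (lq_penalty q)"
  unfolding lq_penalty_def using assms
  by (intro continuous_intros continuous_on_powr') auto

text \<open>
  Clamping \<open>\<bar>t\<bar>\<close> at the breakpoint \<open>\<gamma> * lam\<close> turns the two branches into a single formula that is
  visibly continuous.
\<close>

lemma mcp_continuous:
  assumes "\<gamma> > 0" "lam > 0"
  shows "continuous_on UNIV (mcp \<gamma> lam)"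
proof -
  have "mcp \<gamma> lam = (\<lambda>t. lam * min \<bar>t\<bar> (\<gamma> * lam) - (min \<bar>t\<bar> (\<gamma> * lam))\<^sup>2 / (2 * \<gamma>))"
    using assms by (auto simp: mcp_def fun_eq_iff min_def power2_eq_square field_simps)
  then show ?thesis using assms by (auto intro!: continuous_intros)
qed

text \<open>
  The same device with two breakpoints: \<open>c\<close> clamps \<open>\<bar>t\<bar>\<close> to the interval from \<open>lam\<close> to
  \<open>\<gamma> * lam\<close>, on which the quadratic branch is active.  At \<open>c t = lam\<close> that branch has the value
  \<open>lam\<^sup>2\<close>, which is why \<open>lam\<^sup>2\<close> is subtracted from the sum of the linear and the quadratic term.
\<close>

lemma scad_continuous:
  assumes "\<gamma> > 1" "lam > 0"
  shows "continuous_on UNIV (scad \<gamma> lam)"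
proof -
  define c where "c = (\<lambda>t::real. max lam (min \<bar>t\<bar> (\<gamma> * lam)))"
  have le: "lam \<le> \<gamma> * lam" using assms by simp
  have "scad \<gamma> lam t = lam * min \<bar>t\<bar> lam - lam\<^sup>2
      + (2 * \<gamma> * lam * c t - (c t)\<^sup>2 - lam\<^sup>2) / (2 * \<gamma> - 2)" for t
  proof -
    consider "\<bar>t\<bar> \<le> lam" | "lam < \<bar>t\<bar>" "\<bar>t\<bar> \<le> \<gamma> * lam" | "\<gamma> * lam < \<bar>t\<bar>" by linarith
    then show ?thesis
    proof cases
      case 1
      then have "c t = lam" by (simp add: c_def)
      moreover have "(2 * \<gamma> * lam * lam - lam\<^sup>2 - lam\<^sup>2) / (2 * \<gamma> - 2) = lam\<^sup>2"
        using assms by (simp add: field_simps power2_eq_square)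
      ultimately show ?thesis using 1 by (simp add: scad_def)
    next
      case 2
      then have "c t = \<bar>t\<bar>" by (simp add: c_def)
      then show ?thesis using 2 by (simp add: scad_def power2_eq_square)
    next
      case 3
      then have "c t = \<gamma> * lam" using le by (simp add: c_def)
      moreover have "(2 * \<gamma> * lam * (\<gamma> * lam) - (\<gamma> * lam)\<^sup>2 - lam\<^sup>2) / (2 * \<gamma> - 2)
          = (\<gamma> + 1) * lam\<^sup>2 / 2"
        using assms by (simp add: field_simps power2_eq_square)
      ultimately show ?thesis using 3 le by (simp add: scad_def power2_eq_square)
    qed
  qed
  then have "scad \<gamma> lam = (\<lambda>t. lam * min \<bar>t\<bar> lam - lam\<^sup>2
      + (2 * \<gamma> * lam * c t - (c t)\<^sup>2 - lam\<^sup>2) / (2 * \<gamma> - 2))" by blast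
  then show ?thesis unfolding c_def using assms by (auto intro!: continuous_intros)
qed

section \<open>Smooth functions composed with affine maps\<close>

text \<open>
  The mean value inequality for \<open>g\<close> minus its linearization at \<open>u\<close>, whose gradient is bounded by
  \<open>L * norm (v - u)\<close> on the segment.  Integrating along the segment would give the constant
  \<open>L / 2\<close>; the factor two is absorbed by the choice of \<open>\<beta>\<close>.
\<close>

lemma linearization_error_lipschitz_gradient:
  fixes g :: "'a::euclidean_space \<Rightarrow> real"
  assumes g: "\<And>v. (g has_derivative (\<lambda>h. h \<bullet> G v)) (at v)" and G: "L-lipschitz_on UNIV G"
  shows "\<bar>g v - g u - (v - u) \<bullet> G u\<bar> \<le> L * (norm (v - u))\<^sup>2"
proof -
  have "norm (g v - g u - (v - u) \<bullet> G u) \<le> norm (v - u) * (L * norm (v - u))"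
  proof (rule differentiable_bound_linearization[where S = "closed_segment u v"
        and f' = "\<lambda>v h. h \<bullet> G v"])
    fix y assume y: "y \<in> closed_segment u v"
    have "norm (G y - G u) \<le> L * norm (y - u)"
      using lipschitz_onD[OF G] by (simp add: dist_norm)
    also have "\<dots> \<le> L * norm (v - u)"
      using y lipschitz_on_nonneg[OF G] segment_bound1[OF y] by (intro mult_left_mono) auto
    finally have *: "norm (G y - G u) \<le> L * norm (v - u)" .
    show "onorm ((\<lambda>h. h \<bullet> G y) - (\<lambda>h. h \<bullet> G u)) \<le> L * norm (v - u)"
    proof (rule onorm_le)
      fix h
      have "norm (h \<bullet> (G y - G u)) \<le> norm h * norm (G y - G u)"
        by (simp add: Cauchy_Schwarz_ineq2)
      also have "\<dots> \<le> norm h * (L * norm (v - u))"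
        using * by (intro mult_left_mono) auto
      finally show "norm (((\<lambda>h. h \<bullet> G y) - (\<lambda>h. h \<bullet> G u)) h) \<le> L * norm (v - u) * norm h"
        by (simp add: inner_diff_right mult.commute)
    qed
  next
    fix t :: real assume t: "t \<in> {0..1}"
    have "u + t *\<^sub>R (v - u) = (1 - t) *\<^sub>R u + t *\<^sub>R v" by (simp add: algebra_simps)
    then show "u + t *\<^sub>R (v - u) \<in> closed_segment u v"
      using t by (auto simp: closed_segment_def)
  qed (auto intro: has_derivative_at_withinI g)
  then show ?thesis by (simp add: power2_eq_square mult_ac)
qed

text \<open>
  Since the affine map takes its values in \<open>S\<close>, differentiability relative to \<open>S\<close> is enough for
  differentiability of the composition on the whole space, with gradient
  \<open>transpose A *v H (A *v v - b)\<close> by the chain rule.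
\<close>

lemma lipschitz_differentiable_affine_compose:
  fixes A :: "real^'n^'m" and b :: "real^'m" and f :: "real^'m \<Rightarrow> real"
  assumes f: "lipschitz_differentiable_on S f" and S: "\<And>v. A *v v - b \<in> S"
  shows "\<exists>G L. (\<forall>v. ((\<lambda>v. f (A *v v - b)) has_derivative (\<lambda>h. h \<bullet> G v)) (at v)) \<and>
           L-lipschitz_on UNIV G"
proof -
  obtain H L where H: "\<And>y. y \<in> S \<Longrightarrow> (f has_derivative (\<lambda>h. h \<bullet> H y)) (at y within S)"
    and L: "L-lipschitz_on S H"
    using f unfolding lipschitz_differentiable_on_def by blast
  define G where "G = (\<lambda>v. transpose A *v H (A *v v - b))"
  have "((\<lambda>v. f (A *v v - b)) has_derivative (\<lambda>h. h \<bullet> G v)) (at v)" for v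
  proof -
    have a: "((\<lambda>v. A *v v - b) has_derivative (\<lambda>h. A *v h)) (at v)"
      by (auto intro!: derivative_eq_intros bounded_linear_imp_has_derivative
          matrix_vector_mul_bounded_linear)
    have "(f has_derivative (\<lambda>h. h \<bullet> H (A *v v - b))) (at (A *v v - b) within range (\<lambda>v. A *v v - b))"
      by (rule has_derivative_subset[OF H[OF S]]) (use S in auto)
    from has_derivative_in_compose[OF a this]
    show ?thesis
      by (simp add: G_def dot_lmul_matrix[symmetric] inner_commute matrix_vector_mul_lid
          flip: transpose_matrix_vector)
  qed
  moreover have "\<exists>L. L-lipschitz_on UNIV G"
  proof -
    obtain C where "C-lipschitz_on UNIV ((*v) A)"
      using bounded_linear.lipschitz_boundE[OF matrix_vector_mul_bounded_linear] by metis
    from lipschitz_on_diff[OF this lipschitz_on_constant[of UNIV b]]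
    have C: "C-lipschitz_on UNIV (\<lambda>v. A *v v - b)" by simp
    obtain D where D: "D-lipschitz_on UNIV ((*v) (transpose A))"
      using bounded_linear.lipschitz_boundE[OF matrix_vector_mul_bounded_linear] by metis
    have L': "L-lipschitz_on (range (\<lambda>v. A *v v - b)) H"
      by (rule lipschitz_on_subset[OF L]) (use S in auto)
    have "(D * (L * C))-lipschitz_on UNIV G"
      unfolding G_def
      by (rule lipschitz_on_compose2[OF lipschitz_on_compose2[OF C L'] lipschitz_on_subset[OF D subset_UNIV]])
    then show ?thesis by blast
  qed
  ultimately show ?thesis by blast
qed

section \<open>ADMM for a lower semicontinuous term plus smooth terms\<close>

locale admm_run =
  fixes r :: "'a::euclidean_space \<Rightarrow> real"
    and g :: "'p::finite \<Rightarrow> 'a \<Rightarrow> real" and G :: "'p \<Rightarrow> 'a \<Rightarrow> 'a"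
    and L \<beta> :: real
    and x :: "nat \<Rightarrow> 'a" and z w :: "nat \<Rightarrow> 'a^'p"
  assumes r_lsc: "lower_semicontinuous r"
    and coercive: "coercive (\<lambda>x. r x + (\<Sum>i\<in>UNIV. g i x))"
    and gradient: "\<And>i v. (g i has_derivative (\<lambda>h. h \<bullet> G i v)) (at v)"
    and gradient_lipschitz: "\<And>i. L-lipschitz_on UNIV (G i)"
    and \<beta>_pos: "\<beta> > 0" and \<beta>_large: "\<beta> > 4 * L"
    and x_step: "\<And>k. is_arg_min
          (\<lambda>u. r u + \<beta> / 2 * (\<Sum>i\<in>UNIV. (norm (z k $ i + (w k $ i) /\<^sub>R \<beta> - u))\<^sup>2))
          (\<lambda>_. True) (x (Suc k))"
    and z_step: "\<And>k i. is_arg_min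
             (\<lambda>v. g i v + \<beta> / 2 * (norm (v + (w k $ i) /\<^sub>R \<beta> - x (Suc k)))\<^sup>2)
             (\<lambda>_. True) (z (Suc k) $ i)"
    and w_step: "\<And>k i. w (Suc k) $ i = w k $ i + \<beta> *\<^sub>R (z (Suc k) $ i - x (Suc k))"
begin

text \<open>
  The contribution of one block to the augmented Lagrangian, for primal point \<open>u\<close>, local copy
  \<open>v\<close> and multiplier \<open>y\<close>.
\<close>

definition coupling :: "'p \<Rightarrow> 'a \<Rightarrow> 'a \<Rightarrow> 'a \<Rightarrow> real" where
  "coupling i u v y = g i v + y \<bullet> (v - u) + \<beta> / 2 * (norm (v - u))\<^sup>2"

definition smooth_part :: "'a \<times> ('a^'p) \<times> ('a^'p) \<Rightarrow> real" where
  "smooth_part = (\<lambda>(u, v, y). \<Sum>i\<in>UNIV. coupling i u (v $ i) (y $ i))"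

definition lagrangian :: "'a \<times> ('a^'p) \<times> ('a^'p) \<Rightarrow> real" where
  "lagrangian = (\<lambda>p. r (fst p) + smooth_part p)"

lemma L_nonneg: "0 \<le> L"
  using gradient_lipschitz lipschitz_on_nonneg by blast

lemma gradient_bound: "norm (G i u - G i v) \<le> L * norm (u - v)"
  using lipschitz_onD[OF gradient_lipschitz] by (simp add: dist_norm)

lemma linearization_error: "\<bar>g i v - g i u - (v - u) \<bullet> G i u\<bar> \<le> L * (norm (v - u))\<^sup>2"
  by (rule linearization_error_lipschitz_gradient[OF gradient gradient_lipschitz])

text \<open>
  The squares minimized in the two steps of ADMM differ from the coupling terms of the
  Lagrangian by a constant depending on the multiplier alone, so that both steps minimize the
  Lagrangian in one of its arguments.
\<close>

lemma complete_square:
  "\<beta> / 2 * (norm (v + y /\<^sub>R \<beta> - u))\<^sup>2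
    = y \<bullet> (v - u) + \<beta> / 2 * (norm (v - u))\<^sup>2 + (norm y)\<^sup>2 / (2 * \<beta>)"
proof -
  define d where "d = v - u"
  have e: "v + y /\<^sub>R \<beta> - u = d + y /\<^sub>R \<beta>" by (simp add: d_def)
  show ?thesis unfolding e d_def[symmetric] power2_norm_eq_inner
    using \<beta>_pos by (simp add: inner_add_left inner_add_right inner_commute field_simps)
qed

lemma x_step_lagrangian: "lagrangian (x (Suc k), z k, w k) \<le> lagrangian (u, z k, w k)"
proof -
  have "r (x (Suc k)) + \<beta> / 2 * (\<Sum>i\<in>UNIV. (norm (z k $ i + (w k $ i) /\<^sub>R \<beta> - x (Suc k)))\<^sup>2)
     \<le> r u + \<beta> / 2 * (\<Sum>i\<in>UNIV. (norm (z k $ i + (w k $ i) /\<^sub>R \<beta> - u))\<^sup>2)"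
    using x_step[of k] unfolding is_arg_min_linorder by blast
  then show ?thesis unfolding sum_distrib_left complete_square
    by (simp add: lagrangian_def smooth_part_def coupling_def sum.distrib)
qed

lemma z_step_coupling:
  "coupling i (x (Suc k)) (z (Suc k) $ i) (w k $ i) \<le> coupling i (x (Suc k)) v (w k $ i)"
  using z_step[of i k] unfolding is_arg_min_linorder complete_square coupling_def
  by (simp add: add.assoc)

lemma coupling_has_derivative_z:
  "((\<lambda>v. coupling i u v y) has_derivative (\<lambda>h. h \<bullet> (G i v + y + \<beta> *\<^sub>R (v - u)))) (at v)"
  unfolding coupling_def power2_norm_eq_inner
  by (rule derivative_eq_intros gradient refl)+
    (simp add: fun_eq_iff inner_add_right inner_diff_right inner_diff_left inner_commute algebra_simps)

text \<open>
  The gradient of the function minimized in the \<open>z\<close>-step vanishes at the new \<open>z\<close>, and its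
  part that does not come from \<open>g i\<close> is exactly the updated multiplier.
\<close>

lemma dual_eq_gradient: "w (Suc k) $ i = - G i (z (Suc k) $ i)"
proof -
  have "(\<lambda>h. h \<bullet> (G i (z (Suc k) $ i) + w k $ i + \<beta> *\<^sub>R (z (Suc k) $ i - x (Suc k)))) = (\<lambda>h. 0)"
    by (rule has_derivative_local_min[OF coupling_has_derivative_z])
      (simp add: z_step_coupling)
  then have "G i (z (Suc k) $ i) + w k $ i + \<beta> *\<^sub>R (z (Suc k) $ i - x (Suc k)) = 0"
    by (metis inner_eq_zero_iff)
  then show ?thesis using w_step[of k i]
    by (metis add.assoc add_eq_0_iff)
qed

lemma dual_increment:
  "norm (w (Suc (Suc k)) $ i - w (Suc k) $ i) \<le> L * norm (z (Suc (Suc k)) $ i - z (Suc k) $ i)"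
  using gradient_bound[of i "z (Suc k) $ i" "z (Suc (Suc k)) $ i"]
  by (simp add: dual_eq_gradient norm_minus_commute)

text \<open>
  The effect of the \<open>z\<close>-step and the multiplier update on one block.  Their joint effect is an
  exact identity, because the new multiplier is minus the gradient at the new \<open>z\<close>.  With
  \<open>L < \<beta> / 4\<close> the linearization error costs at most \<open>\<beta> / 4\<close> and the multiplier update at most
  \<open>\<beta> / 8\<close> of the available \<open>\<beta> / 2\<close>, in units of the squared increment of \<open>z\<close>.  The indices
  start at \<open>Suc k\<close> because the initial multiplier is arbitrary and need not be a gradient.
\<close>

lemma coupling_descent:
  "coupling i (x (Suc (Suc k))) (z (Suc (Suc k)) $ i) (w (Suc (Suc k)) $ i)
     + \<beta> / 8 * (norm (z (Suc (Suc k)) $ i - z (Suc k) $ i))\<^sup>2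
   \<le> coupling i (x (Suc (Suc k))) (z (Suc k) $ i) (w (Suc k) $ i)"
proof -
  define u v v' y y' where "u = x (Suc (Suc k))" and "v = z (Suc k) $ i"
    and "v' = z (Suc (Suc k)) $ i" and "y = w (Suc k) $ i" and "y' = w (Suc (Suc k)) $ i"
  note defs = u_def v_def v'_def y_def y'_def
  have y': "y' = y + \<beta> *\<^sub>R (v' - u)" unfolding defs by (rule w_step)
  have grad: "G i v' = - y'" unfolding defs by (simp add: dual_eq_gradient)
  have "(norm (y' - y))\<^sup>2 \<le> (L * norm (v' - v))\<^sup>2"
    unfolding defs by (intro power_mono dual_increment) auto
  then have dual: "\<beta> * (\<beta> * (norm (v' - u))\<^sup>2) \<le> L\<^sup>2 * (norm (v' - v))\<^sup>2"
    using \<beta>_pos by (simp add: y' power_mult_distrib power2_eq_square mult_ac)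
  also have "\<dots> \<le> \<beta> * (\<beta> / 8) * (norm (v' - v))\<^sup>2"
  proof (intro mult_right_mono)
    have "L\<^sup>2 \<le> (\<beta> / 4)\<^sup>2" using L_nonneg \<beta>_large by (intro power_mono) auto
    then show "L\<^sup>2 \<le> \<beta> * (\<beta> / 8)" by (simp add: power2_eq_square) (use \<beta>_pos in \<open>smt (verit) mult_pos_pos\<close>)
  qed auto
  finally have dual': "\<beta> * (norm (v' - u))\<^sup>2 \<le> \<beta> / 8 * (norm (v' - v))\<^sup>2"
    using \<beta>_pos by (simp add: mult.assoc)
  have lin: "g i v' + (v - v') \<bullet> G i v' - L * (norm (v' - v))\<^sup>2 \<le> g i v"
    using linearization_error[of i v v'] by (simp add: norm_minus_commute abs_le_iff)
  have Lb: "L * (norm (v' - v))\<^sup>2 \<le> \<beta> / 4 * (norm (v' - v))\<^sup>2"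
    using \<beta>_large by (intro mult_right_mono) auto
  \<comment> \<open>The gain \<open>\<beta> / 2\<close> is the curvature of the quadratic term in the \<open>z\<close>-step;
    the last term is the loss in the multiplier update.\<close>
  have "coupling i u v y - coupling i u v' y'
      = g i v - g i v' - (v - v') \<bullet> G i v' + \<beta> / 2 * (norm (v' - v))\<^sup>2 - \<beta> * (norm (v' - u))\<^sup>2"
    unfolding coupling_def power2_norm_eq_inner grad y'
    by (simp add: inner_diff_left inner_diff_right inner_add_left inner_add_right inner_commute
        algebra_simps)
  then show ?thesis using dual' lin Lb unfolding defs by simp
qed

lemma lagrangian_descent:
  "lagrangian (x (Suc (Suc k)), z (Suc (Suc k)), w (Suc (Suc k)))
     + \<beta> / 8 * (\<Sum>i\<in>UNIV. (norm (z (Suc (Suc k)) $ i - z (Suc k) $ i))\<^sup>2)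
   \<le> lagrangian (x (Suc k), z (Suc k), w (Suc k))"
proof -
  have "lagrangian (x (Suc (Suc k)), z (Suc (Suc k)), w (Suc (Suc k)))
     + \<beta> / 8 * (\<Sum>i\<in>UNIV. (norm (z (Suc (Suc k)) $ i - z (Suc k) $ i))\<^sup>2)
    \<le> lagrangian (x (Suc (Suc k)), z (Suc k), w (Suc k))"
    using sum_mono[of UNIV, OF coupling_descent[of _ k]]
    by (simp add: lagrangian_def smooth_part_def sum.distrib sum_distrib_left)
  also have "\<dots> \<le> lagrangian (x (Suc k), z (Suc k), w (Suc k))"
    by (rule x_step_lagrangian)
  finally show ?thesis .
qed

text \<open>
  With multiplier \<open>- G i v\<close> the linear coupling term is the first-order change of \<open>g i\<close> from
  \<open>v\<close> to \<open>u\<close>, so that up to the linearization error the value at the copy may be replaced by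
  the value at \<open>u\<close>.
\<close>

lemma lagrangian_lower_bound:
  "r (x (Suc k)) + (\<Sum>i\<in>UNIV. g i (x (Suc k)))
     + \<beta> / 4 * (\<Sum>i\<in>UNIV. (norm (z (Suc k) $ i - x (Suc k)))\<^sup>2)
   \<le> lagrangian (x (Suc k), z (Suc k), w (Suc k))"
proof -
  have "g i u + \<beta> / 4 * (norm (v - u))\<^sup>2 \<le> coupling i u v (- G i v)" for i u v
  proof -
    have "g i u \<le> g i v + (u - v) \<bullet> G i v + L * (norm (v - u))\<^sup>2"
      using linearization_error[of i u v] by (simp add: norm_minus_commute abs_le_iff)
    moreover have "L * (norm (v - u))\<^sup>2 \<le> \<beta> / 4 * (norm (v - u))\<^sup>2"
      using \<beta>_large by (intro mult_right_mono) auto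
    ultimately show ?thesis
      unfolding coupling_def by (simp add: inner_diff_left inner_diff_right inner_commute)
  qed
  then show ?thesis
    unfolding lagrangian_def smooth_part_def
    by (simp add: sum_distrib_left dual_eq_gradient add.assoc flip: sum.distrib)
      (intro sum_mono, simp)
qed

lemma objective_bounded_below: "\<exists>m. \<forall>u. m \<le> r u + (\<Sum>i\<in>UNIV. g i u)"
proof (rule coercive_lower_semicontinuous_bounded_below[OF coercive])
  have "continuous_on UNIV (\<lambda>u. \<Sum>i\<in>UNIV. g i u)"
    using gradient by (intro continuous_on_sum) (meson continuous_at_imp_continuous_on has_derivative_continuous)
  with r_lsc show "lower_semicontinuous (\<lambda>u. r u + (\<Sum>i\<in>UNIV. g i u))"
    by (rule lower_semicontinuous_add_continuous)
qed

lemma lagrangian_values_decseq: "decseq (\<lambda>k. lagrangian (x (Suc k), z (Suc k), w (Suc k)))"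
proof (rule decseq_SucI)
  fix k
  have "0 \<le> \<beta> / 8 * (\<Sum>i\<in>UNIV. (norm (z (Suc (Suc k)) $ i - z (Suc k) $ i))\<^sup>2)"
    using \<beta>_pos by (intro mult_nonneg_nonneg sum_nonneg) auto
  then show "lagrangian (x (Suc (Suc k)), z (Suc (Suc k)), w (Suc (Suc k)))
      \<le> lagrangian (x (Suc k), z (Suc k), w (Suc k))"
    using lagrangian_descent[of k] by linarith
qed

lemma lagrangian_values_bounded_below:
  "\<exists>m. \<forall>k. m \<le> lagrangian (x (Suc k), z (Suc k), w (Suc k))"
proof -
  obtain m where m: "\<And>u. m \<le> r u + (\<Sum>i\<in>UNIV. g i u)" using objective_bounded_below by blast
  have "m \<le> lagrangian (x (Suc k), z (Suc k), w (Suc k))" for k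
  proof -
    have "0 \<le> \<beta> / 4 * (\<Sum>i\<in>UNIV. (norm (z (Suc k) $ i - x (Suc k)))\<^sup>2)"
      using \<beta>_pos by (intro mult_nonneg_nonneg sum_nonneg) auto
    then show ?thesis using m[of "x (Suc k)"] lagrangian_lower_bound[of k] by linarith
  qed
  then show ?thesis by blast
qed

text \<open>
  The values of the Lagrangian converge, being monotone and bounded below, so their successive
  differences, which dominate the squared increments, tend to zero.
\<close>

lemma z_increments_tendsto_0: "(\<lambda>k. z (Suc k) $ i - z k $ i) \<longlonglongrightarrow> 0"
proof -
  define \<Lambda> where "\<Lambda> = (\<lambda>k. lagrangian (x (Suc k), z (Suc k), w (Suc k)))"
  obtain m where "\<And>k. m \<le> \<Lambda> k" using lagrangian_values_bounded_below unfolding \<Lambda>_def by blast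
  then obtain l where l: "\<Lambda> \<longlonglongrightarrow> l"
    using decseq_convergent[of \<Lambda> m] lagrangian_values_decseq unfolding \<Lambda>_def by blast
  have 0: "(\<lambda>k. 8 / \<beta> * (\<Lambda> k - \<Lambda> (Suc k))) \<longlonglongrightarrow> 8 / \<beta> * (l - l)"
    by (intro tendsto_intros l LIMSEQ_Suc)
  have "(\<lambda>k. (norm (z (Suc (Suc k)) $ i - z (Suc k) $ i))\<^sup>2) \<longlonglongrightarrow> 0"
  proof (rule tendsto_sandwich[OF _ _ tendsto_const 0[unfolded diff_self mult_zero_right]]; intro always_eventually allI)
    fix k
    have "(norm (z (Suc (Suc k)) $ i - z (Suc k) $ i))\<^sup>2
        \<le> (\<Sum>i\<in>UNIV. (norm (z (Suc (Suc k)) $ i - z (Suc k) $ i))\<^sup>2)"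
      by (rule member_le_sum) auto
    then have "\<beta> / 8 * (norm (z (Suc (Suc k)) $ i - z (Suc k) $ i))\<^sup>2
        \<le> \<beta> / 8 * (\<Sum>i\<in>UNIV. (norm (z (Suc (Suc k)) $ i - z (Suc k) $ i))\<^sup>2)"
      using \<beta>_pos by (intro mult_left_mono) auto
    then have "\<beta> / 8 * (norm (z (Suc (Suc k)) $ i - z (Suc k) $ i))\<^sup>2 \<le> \<Lambda> k - \<Lambda> (Suc k)"
      using lagrangian_descent[of k] unfolding \<Lambda>_def by linarith
    then show "(norm (z (Suc (Suc k)) $ i - z (Suc k) $ i))\<^sup>2 \<le> 8 / \<beta> * (\<Lambda> k - \<Lambda> (Suc k))"
      using \<beta>_pos by (simp add: field_simps)
  qed simp
  then have "(\<lambda>k. norm (z (Suc (Suc k)) $ i - z (Suc k) $ i)) \<longlonglongrightarrow> 0"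
    using tendsto_real_sqrt[of "\<lambda>k. (norm (z (Suc (Suc k)) $ i - z (Suc k) $ i))\<^sup>2" 0] by simp
  then have "(\<lambda>k. z (Suc (Suc k)) $ i - z (Suc k) $ i) \<longlonglongrightarrow> 0"
    by (rule tendsto_norm_zero_cancel)
  then show ?thesis by (rule LIMSEQ_imp_Suc)
qed

lemma w_increments_tendsto_0: "(\<lambda>k. w (Suc k) $ i - w k $ i) \<longlonglongrightarrow> 0"
proof (rule LIMSEQ_imp_Suc, rule Lim_null_comparison)
  show "\<forall>\<^sub>F k in sequentially. norm (w (Suc (Suc k)) $ i - w (Suc k) $ i)
      \<le> L * norm (z (Suc (Suc k)) $ i - z (Suc k) $ i)"
    using dual_increment by simp
  show "(\<lambda>k. L * norm (z (Suc (Suc k)) $ i - z (Suc k) $ i)) \<longlonglongrightarrow> 0"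
    using LIMSEQ_Suc[OF z_increments_tendsto_0[of i]]
    by (intro tendsto_mult_right_zero tendsto_norm_zero)
qed

lemma residual_tendsto_0: "(\<lambda>k. z k $ i - x k) \<longlonglongrightarrow> 0"
proof (rule LIMSEQ_imp_Suc)
  have "(\<lambda>k. (w (Suc k) $ i - w k $ i) /\<^sub>R \<beta>) \<longlonglongrightarrow> 0 /\<^sub>R \<beta>"
    by (intro tendsto_intros w_increments_tendsto_0)
  then show "(\<lambda>k. z (Suc k) $ i - x (Suc k)) \<longlonglongrightarrow> 0"
    using \<beta>_pos by (simp add: w_step)
qed

text \<open>
  The objective at \<open>x (Suc k)\<close> stays below the first value of the Lagrangian, so coercivity bounds
  \<open>x\<close>; then \<open>z\<close> is bounded since the residual converges, and \<open>w\<close> since it is a gradient at \<open>z\<close>.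
\<close>

lemma bounded_iterates: "bounded (range (\<lambda>k. (x k, z k, w k)))"
proof -
  define c where "c = lagrangian (x 1, z 1, w 1)"
  obtain R where R: "\<And>u. r u + (\<Sum>i\<in>UNIV. g i u) \<le> c \<Longrightarrow> norm u \<le> R"
    using coercive_sublevel_bounded[OF coercive] by metis
  have x1: "norm (x (Suc k)) \<le> R" for k
  proof (rule R)
    have "0 \<le> \<beta> / 4 * (\<Sum>i\<in>UNIV. (norm (z (Suc k) $ i - x (Suc k)))\<^sup>2)"
      using \<beta>_pos by (intro mult_nonneg_nonneg sum_nonneg) auto
    then show "r (x (Suc k)) + (\<Sum>i\<in>UNIV. g i (x (Suc k))) \<le> c"
      using lagrangian_lower_bound[of k] decseqD[OF lagrangian_values_decseq, of 0 k]
      unfolding c_def by simp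
  qed
  have "Bseq (\<lambda>k. x (Suc k))" using x1 by (rule BseqI')
  then have x: "Bseq x" by (simp add: Bseq_Suc_iff)
  have zi: "Bseq (\<lambda>k. z k $ i)" for i
  proof -
    have "Bseq (\<lambda>k. z k $ i - x k)"
      using residual_tendsto_0 by (meson convergentI convergent_imp_Bseq)
    then obtain K where K: "\<And>k. norm (z k $ i - x k) \<le> K" by (auto simp: Bseq_def)
    obtain R' where R': "\<And>k. norm (x k) \<le> R'" using x by (auto simp: Bseq_def)
    have "norm (z k $ i) \<le> K + R'" for k
      using norm_triangle_ineq[of "z k $ i - x k" "x k"] K[of k] R'[of k] by simp
    then show ?thesis by (rule BseqI')
  qed
  have wi: "Bseq (\<lambda>k. w k $ i)" for i
  proof -
    obtain K where K: "\<And>k. norm (z k $ i) \<le> K" using zi[of i] by (auto simp: Bseq_def)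
    have "norm (w (Suc k) $ i) \<le> norm (G i 0) + L * K" for k
    proof -
      have "norm (w (Suc k) $ i) \<le> norm (G i 0) + norm (G i (z (Suc k) $ i) - G i 0)"
        by (simp add: dual_eq_gradient norm_triangle_sub)
      also have "norm (G i (z (Suc k) $ i) - G i 0) \<le> L * norm (z (Suc k) $ i - 0)"
        by (rule gradient_bound)
      also have "L * norm (z (Suc k) $ i - 0) \<le> L * K" using K L_nonneg by (simp add: mult_left_mono)
      finally show ?thesis by simp
    qed
    then have "Bseq (\<lambda>k. w (Suc k) $ i)" by (rule BseqI')
    then show ?thesis using Bseq_Suc_iff[of "\<lambda>k. w k $ i"] by simp
  qed
  have vec: "Bseq v" if "\<And>i. Bseq (\<lambda>k. v k $ i)" for v :: "nat \<Rightarrow> 'a^'p"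
  proof -
    have "\<forall>i. \<exists>K. \<forall>k. norm (v k $ i) \<le> K" using that by (auto simp: Bseq_def)
    then obtain K where K: "\<And>i k. norm (v k $ i) \<le> K i" by metis
    have "norm (v k) \<le> (\<Sum>i\<in>UNIV. K i)" for k
      unfolding norm_vec_def by (rule order_trans[OF L2_set_le_sum sum_mono]) (use K in auto)
    then show ?thesis by (rule BseqI')
  qed
  have range: "bounded (range v)" if "Bseq v" for v :: "nat \<Rightarrow> 'b::real_normed_vector"
    using that by (auto simp: Bseq_def bounded_iff)
  have "bounded (range x \<times> range z \<times> range w)"
    by (intro bounded_Times range vec x zi wi)
  then show ?thesis by (rule bounded_subset) auto
qed

lemma limit_point_exists: "\<exists>u. seq_limit_point (\<lambda>k. (x k, z k, w k)) u"
  using bounded_imp_convergent_subsequence[OF bounded_iterates] unfolding seq_limit_point_def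
  by blast

lemma smooth_part_has_derivative:
  "(smooth_part has_derivative (\<lambda>h. h \<bullet>
      (- (\<Sum>i\<in>UNIV. y $ i + \<beta> *\<^sub>R (v $ i - u)),
       (\<chi> i. G i (v $ i) + y $ i + \<beta> *\<^sub>R (v $ i - u)),
       (\<chi> i. v $ i - u)))) (at (u, v, y))"
proof -
  have v: "((\<lambda>p. fst (snd p) $ i) has_derivative (\<lambda>h. fst (snd h) $ i)) (at (u, v, y))"
    and y: "((\<lambda>p. snd (snd p) $ i) has_derivative (\<lambda>h. snd (snd h) $ i)) (at (u, v, y))" for i
    by (intro bounded_linear.has_derivative[OF bounded_linear_vec_nth] derivative_intros)+
  have g: "((\<lambda>p. g i (fst (snd p) $ i)) has_derivative (\<lambda>h. (fst (snd h) $ i) \<bullet> G i (v $ i)))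
      (at (u, v, y))" for i
    using has_derivative_compose[OF v gradient] by simp
  have eq: "smooth_part = (\<lambda>p. \<Sum>i\<in>UNIV. g i (fst (snd p) $ i)
      + (snd (snd p) $ i) \<bullet> (fst (snd p) $ i - fst p)
      + \<beta> / 2 * ((fst (snd p) $ i - fst p) \<bullet> (fst (snd p) $ i - fst p)))"
    by (auto simp: smooth_part_def coupling_def power2_norm_eq_inner fun_eq_iff)
  show ?thesis unfolding eq
    by (rule derivative_eq_intros g v y refl)+
      (auto simp: fun_eq_iff inner_prod_def inner_vec_def inner_sum_right sum_negf[symmetric] sum.distrib[symmetric]
        inner_add_right inner_diff_right inner_diff_left inner_commute algebra_simps intro!: sum.cong)
qed

text \<open>
  Fermat's rule for the \<open>x\<close>-step: zero is a regular subgradient of the Lagrangian in \<open>x\<close>, and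
  the smooth part is then subtracted.
\<close>

lemma r_regular_subgradient:
  "(\<Sum>i\<in>UNIV. w k $ i + \<beta> *\<^sub>R (z k $ i - x (Suc k))) \<in> regular_subdifferential r (x (Suc k))"
proof -
  have "0 \<in> regular_subdifferential (\<lambda>u. lagrangian (u, z k, w k)) (x (Suc k))"
    by (rule regular_subdifferential_minimizer) (rule x_step_lagrangian)
  moreover have "((\<lambda>u. - smooth_part (u, z k, w k)) has_derivative
      (\<lambda>h. h \<bullet> (\<Sum>i\<in>UNIV. w k $ i + \<beta> *\<^sub>R (z k $ i - x (Suc k))))) (at (x (Suc k)))"
  proof -
    have "((\<lambda>u. (u, z k, w k)) has_derivative (\<lambda>h. (h, 0, 0))) (at (x (Suc k)))"
      by (auto intro!: derivative_eq_intros simp: zero_prod_def)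
    from has_derivative_minus[OF has_derivative_compose[OF this smooth_part_has_derivative]]
    show ?thesis by (simp add: inner_prod_def)
  qed
  ultimately show ?thesis
    using regular_subdifferential_add_differentiable
    by (fastforce simp: lagrangian_def)
qed

text \<open>
  The subgradient of \<open>r\<close> involves the old \<open>z\<close> and \<open>w\<close>, the gradient of the smooth part the new
  ones.  Hence the first entry consists of increments; in the second, \<open>G i z\<close> and \<open>w\<close> cancel.
\<close>

lemma lagrangian_regular_subgradient:
  "((\<Sum>i\<in>UNIV. (w k $ i - w (Suc k) $ i) + \<beta> *\<^sub>R (z k $ i - z (Suc k) $ i)),
    (\<chi> i. \<beta> *\<^sub>R (z (Suc k) $ i - x (Suc k))),
    (\<chi> i. z (Suc k) $ i - x (Suc k)))
   \<in> regular_subdifferential lagrangian (x (Suc k), z (Suc k), w (Suc k))"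
  using regular_subdifferential_add_differentiable[OF
      regular_subdifferential_fst[OF r_regular_subgradient]
      smooth_part_has_derivative[of "w (Suc k)" "z (Suc k)" "x (Suc k)"]]
  by (simp add: lagrangian_def dual_eq_gradient zero_prod_def sum_subtractf[symmetric] algebra_simps)

lemma limit_point_stationary:
  assumes "seq_limit_point (\<lambda>k. (x k, z k, w k)) p"
  shows "stationary_point lagrangian p"
proof -
  obtain u v y where p: "p = (u, v, y)" by (cases p) auto
  obtain s where s: "strict_mono s" "((\<lambda>k. (x k, z k, w k)) \<circ> s) \<longlonglongrightarrow> p"
    using assms unfolding seq_limit_point_def by blast
  \<comment> \<open>Each point of the shifted subsequence is the outcome of a full iteration, the one that starts
    from the iterate with index \<open>j k\<close>.\<close>
  define j where "j = (\<lambda>k. s (Suc k) - 1)"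
  have Suc_j: "Suc (j k) = s (Suc k)" for k
    using strict_mono_less[OF s(1), of 0 "Suc k"] by (simp add: j_def)
  have j: "filterlim j sequentially sequentially"
  proof -
    have "strict_mono j" using strict_monoD[OF s(1)] Suc_j
      by (metis Suc_less_eq strict_mono_def)
    then show ?thesis by (rule filterlim_subseq)
  qed
  define X where "X = (\<lambda>k. (x (Suc (j k)), z (Suc (j k)), w (Suc (j k))))"
  have X: "X \<longlonglongrightarrow> p"
    using LIMSEQ_Suc[OF s(2)] by (simp add: X_def Suc_j o_def)
  define V where "V = (\<lambda>k. ((\<Sum>i\<in>UNIV. (w (j k) $ i - w (Suc (j k)) $ i)
       + \<beta> *\<^sub>R (z (j k) $ i - z (Suc (j k)) $ i)),
    (\<chi> i. \<beta> *\<^sub>R (z (Suc (j k)) $ i - x (Suc (j k)))) :: 'a^'p,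
    (\<chi> i. z (Suc (j k)) $ i - x (Suc (j k))) :: 'a^'p))"
  have V_in: "V k \<in> regular_subdifferential lagrangian (X k)" for k
    unfolding V_def X_def by (rule lagrangian_regular_subgradient)
  have dz: "(\<lambda>k. z (j k) $ i - z (Suc (j k)) $ i) \<longlonglongrightarrow> 0" for i
    using filterlim_compose[OF tendsto_minus[OF z_increments_tendsto_0[of i]] j] by simp
  have dw: "(\<lambda>k. w (j k) $ i - w (Suc (j k)) $ i) \<longlonglongrightarrow> 0" for i
    using filterlim_compose[OF tendsto_minus[OF w_increments_tendsto_0[of i]] j] by simp
  have res: "(\<lambda>k. z (Suc (j k)) $ i - x (Suc (j k))) \<longlonglongrightarrow> 0" for i
    using filterlim_compose[OF LIMSEQ_Suc[OF residual_tendsto_0[of i]] j] by simp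
  have "(\<lambda>k. (w (j k) $ i - w (Suc (j k)) $ i) + \<beta> *\<^sub>R (z (j k) $ i - z (Suc (j k)) $ i))
      \<longlonglongrightarrow> 0 + \<beta> *\<^sub>R 0" for i
    by (intro tendsto_intros dz dw)
  then have "V \<longlonglongrightarrow> (\<Sum>i\<in>(UNIV :: 'p set). 0 + \<beta> *\<^sub>R 0, \<chi> i. \<beta> *\<^sub>R 0, \<chi> i. 0)"
    unfolding V_def by (intro tendsto_Pair tendsto_sum tendsto_vec_lambda tendsto_scaleR tendsto_const res)
  then have V: "V \<longlonglongrightarrow> 0" by (simp add: zero_prod_def zero_vec_def)
  have smooth: "isCont smooth_part q" for q
    by (cases q) (auto intro: has_derivative_continuous[OF smooth_part_has_derivative])
  have Xs: "(\<lambda>k. smooth_part (X k)) \<longlonglongrightarrow> smooth_part p"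
    using isCont_tendsto_compose[OF smooth X] .
  have r: "(\<lambda>k. r (fst (X k))) \<longlonglongrightarrow> r u"
  proof (rule order_tendstoI)
    fix a assume "a < r u"
    moreover have "(\<lambda>k. fst (X k)) \<longlonglongrightarrow> u" using tendsto_fst[OF X] p by simp
    ultimately show "\<forall>\<^sub>F k in sequentially. a < r (fst (X k))"
      using lower_semicontinuous_sequentially[OF r_lsc] by blast
  next
    \<comment> \<open>Compare \<open>x (Suc (j k))\<close> with the limit \<open>u\<close> in the \<open>x\<close>-step; this involves the previous
      \<open>z\<close> and \<open>w\<close>, which have the same limits because the increments vanish.\<close>
    fix a assume a: "r u < a"
    have zj: "(\<lambda>k. z (j k)) \<longlonglongrightarrow> v"
    proof (rule vec_tendstoI)
      fix i
      have "(\<lambda>k. (z (j k) $ i - z (Suc (j k)) $ i) + fst (snd (X k)) $ i) \<longlonglongrightarrow> 0 + fst (snd p) $ i"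
        by (intro tendsto_intros dz X)
      then show "(\<lambda>k. z (j k) $ i) \<longlonglongrightarrow> v $ i" by (simp add: X_def p)
    qed
    have wj: "(\<lambda>k. w (j k)) \<longlonglongrightarrow> y"
    proof (rule vec_tendstoI)
      fix i
      have "(\<lambda>k. (w (j k) $ i - w (Suc (j k)) $ i) + snd (snd (X k)) $ i) \<longlonglongrightarrow> 0 + snd (snd p) $ i"
        by (intro tendsto_intros dw X)
      then show "(\<lambda>k. w (j k) $ i) \<longlonglongrightarrow> y $ i" by (simp add: X_def p)
    qed
    have xj: "(\<lambda>k. x (Suc (j k))) \<longlonglongrightarrow> u" using tendsto_fst[OF X] by (simp add: X_def p)
    have "(\<lambda>k. r u + smooth_part (u, z (j k), w (j k)) - smooth_part (x (Suc (j k)), z (j k), w (j k)))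
        \<longlonglongrightarrow> r u + smooth_part (u, v, y) - smooth_part (u, v, y)"
      by (intro tendsto_intros isCont_tendsto_compose[OF smooth] xj zj wj)
    then have "\<forall>\<^sub>F k in sequentially.
        r u + smooth_part (u, z (j k), w (j k)) - smooth_part (x (Suc (j k)), z (j k), w (j k)) < a"
      using a by (intro order_tendstoD(2)) auto
    then show "\<forall>\<^sub>F k in sequentially. r (fst (X k)) < a"
    proof eventually_elim
      case (elim k)
      then show ?case using x_step_lagrangian[of "j k" u] by (simp add: lagrangian_def X_def)
    qed
  qed
  have "(\<lambda>k. lagrangian (X k)) \<longlonglongrightarrow> lagrangian p"
    unfolding lagrangian_def using tendsto_add[OF r Xs] by (simp add: p)
  then show ?thesis
    unfolding stationary_point_def limiting_subdifferential_def
    using X V V_in by blast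
qed

end

section \<open>The penalized problem\<close>

theorem corollary1:
  fixes r :: "real^'n::finite \<Rightarrow> real"
    and M :: "'p::finite \<Rightarrow> 'm::finite set"
    and l :: "'p \<Rightarrow> real^'m \<Rightarrow> real"
    and A :: "'p \<Rightarrow> real^'n^'m"
    and b :: "'p \<Rightarrow> real^'m"
  assumes A_dim: "\<And>i j. j \<notin> M i \<Longrightarrow> row j (A i) = 0"
    and b_dim: "\<And>i. b i \<in> coord_space (M i)"
    and r_form:
      "(\<exists>q. 0 < q \<and> q \<le> 1 \<and> r = lq_penalty q) \<or>
       (\<exists>\<gamma> lam. \<gamma> > 1 \<and> lam > 0 \<and> r = (\<lambda>x. \<Sum>j\<in>UNIV. scad \<gamma> lam (x $ j))) \<or>
       (\<exists>\<gamma> lam. \<gamma> > 0 \<and> lam > 0 \<and> r = (\<lambda>x. \<Sum>j\<in>UNIV. mcp \<gamma> lam (x $ j))) \<or>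
       (piecewise_linear r \<and> lower_semicontinuous r)"
    and coercivity: "coercive (\<lambda>x. r x + (\<Sum>i\<in>UNIV. l i (A i *v x - b i)))"
    and smoothness: "\<And>i. lipschitz_differentiable_on (coord_space (M i)) (l i)"
  shows "\<exists>\<beta>0>0. \<forall>\<beta>\<ge>\<beta>0. \<forall>x z w. admm_sequence r l A b \<beta> x z w \<longrightarrow>
           (\<exists>u. seq_limit_point (\<lambda>k. (x k, z k, w k)) u) \<and>
           (\<forall>u. seq_limit_point (\<lambda>k. (x k, z k, w k)) u \<longrightarrow>
                stationary_point (aug_lagrangian r l A b \<beta>) u)"
proof -
  define g where "g = (\<lambda>i v. l i (A i *v v - b i))"
  have penalty_sum: "continuous_on UNIV (\<lambda>x :: real^'n. \<Sum>j\<in>UNIV. P (x $ j))"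
    if "continuous_on UNIV P" for P :: "real \<Rightarrow> real"
    by (intro continuous_on_sum continuous_on_compose2[OF that] continuous_intros) auto
  have "continuous_on UNIV r \<or> lower_semicontinuous r"
    using r_form lq_penalty_continuous penalty_sum[OF scad_continuous] penalty_sum[OF mcp_continuous]
    by blast
  then have lsc: "lower_semicontinuous r"
    using continuous_imp_lower_semicontinuous by blast
  have in_space: "A i *v v - b i \<in> coord_space (M i)" for i v
  proof -
    have "(A i *v v) $ j = 0" if "j \<notin> M i" for j
      using A_dim[OF that] by (simp add: matrix_vector_mult_def row_def vec_eq_iff)
    then show ?thesis using b_dim[of i] by (simp add: coord_space_def)
  qed
  have "\<exists>G L. (\<forall>v. (g i has_derivative (\<lambda>h. h \<bullet> G v)) (at v)) \<and> L-lipschitz_on UNIV G" for i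
    unfolding g_def by (rule lipschitz_differentiable_affine_compose[OF smoothness in_space])
  then obtain G K where G: "\<And>i v. (g i has_derivative (\<lambda>h. h \<bullet> G i v)) (at v)"
    and K: "\<And>i. (K i)-lipschitz_on UNIV (G i)" by metis
  define L where "L = (\<Sum>i\<in>UNIV. K i)"
  have L: "L-lipschitz_on UNIV (G i)" for i
  proof (rule lipschitz_on_le[OF K])
    show "K i \<le> L" unfolding L_def using lipschitz_on_nonneg[OF K] by (intro member_le_sum) auto
  qed
  have L_nonneg: "L \<ge> 0" using lipschitz_on_nonneg[OF L] .
  show ?thesis
  proof (intro exI[of _ "4 * L + 1"] conjI allI impI)
    fix \<beta> x z w
    assume \<beta>: "4 * L + 1 \<le> \<beta>" and run: "admm_sequence r l A b \<beta> x z w"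
    interpret admm_run r g G L \<beta> x z w
      using lsc coercivity G L \<beta> L_nonneg run
      by unfold_locales (auto simp: admm_sequence_def g_def)
    have lag: "lagrangian = aug_lagrangian r l A b \<beta>"
      by (simp add: lagrangian_def smooth_part_def coupling_def aug_lagrangian_def fun_eq_iff)
        (simp add: g_def)
    show "\<exists>u. seq_limit_point (\<lambda>k. (x k, z k, w k)) u" by (rule limit_point_exists)
    show "stationary_point (aug_lagrangian r l A b \<beta>) u"
      if "seq_limit_point (\<lambda>k. (x k, z k, w k)) u" for u
      using limit_point_stationary[OF that] unfolding lag .
  qed (use L_nonneg in simp)
qed

end
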